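(* Let $P$ be a program and $I$ a four-valued interpretation with $I\sqsupseteq^{\mathbf{4}}\mathrm{lfp}(\Phi_P)$. Then no ground atom that is $\mathbf{t}$ in $I$ can finitely fail, no ground atom that is $\mathbf{f}$ in $I$ can succeed, and no ground atom that is $\mathbf{u}$ in $I$ can finitely fail or succeed.
   Context: Programs: atoms are $p(t_1,\ldots,t_n)$ over a fixed first-order alphabet, with a distinguished binary equality predicate $=$. A literal is an atom $A$ or its negation $\neg A$; a conjunction is a conjunction of literals; a disjunction is $C_1\lor\cdots\lor C_k$ ($k>0$) with each $C_i$ a conjunction. A predicate definition is a pair $(H,\exists W[D])$ where $H=p(V_1,\ldots,V_n)$ with distinct variables $V_i$, $D$ is a disjunction, and $W=\mathrm{vars}(D)\setminus\mathrm{vars}(H)$. A program is a finite set of predicate definitions with pairwise distinct head predicate symbols (a pure Prolog program with sound negation, written as its completion). A head grounding of a definition is an instance in which only the head variables are replaced by terms, so that the head becomes ground. $\mathcal{G}$ is the set of ground atoms. Truth values $\mathbf{4}=\{\mathbf{u},\mathbf{f},\mathbf{t},\mathbf{i}\}$ with information order $\sqsubseteq$: $\mathbf{u}\sqsubseteq x\sqsubseteq\mathbf{i}$ for all $x$, $x\sqsubseteq x$, $\mathbf{f},\mathbf{t}$ incomparable. Interpretations: pairs $I=(T_I,F_I)$ of subsets of $\mathcal{G}$, where a ground equality atom $s=s'$ lies in $T_I$ (and not $F_I$) if $s,s'$ are identical and in $F_I$ (and not $T_I$) otherwise. $I$ makes a ground atom $A$ true iff $A\in T_I$, false iff $A\in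 F_I$; $\neg A$ true iff $A\in F_I$, false iff $A\in T_I$; a ground conjunction true iff all conjuncts true, false iff some conjunct false; a ground disjunction true iff some disjunct true, false iff all false; $\exists W[D]$ true iff some ground instance of $D$ is made true, false iff all ground instances are made false. $I(F)$ is $\mathbf{u}$ (neither), $\mathbf{f}$ (false only), $\mathbf{t}$ (true only), $\mathbf{i}$ (both). Interpretations ordered pointwise: $I\sqsubseteq J$ iff $T_I\subseteq T_J$ and $F_I\subseteq F_J$. $\Phi_P(I)$ is the interpretation in which every ground non-equality atom $A$ has value $I(B)$, where $(A,B)$ is the head grounding with head $A$ of the definition in $P$ of $A$'s predicate; equality atoms keep their fixed values. $\mathrm{lfp}(\Phi_P)$ is its $\sqsubseteq$-least fixed point. Operational notions: a ground atom succeeds if it has a successful SLDNF derivation from $P$, and finitely fails if it has a finitely failed SLDNF tree (idealised execution). *)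

theory Defs
  imports Main "HOL-Library.Product_Order"
begin

section \<open>Syntax\<close>

datatype 'f trm = Var nat | Fun 'f "'f trm list"

text \<open>Equality is a constructor of its own, so that no program can redefine it.\<close>

datatype ('f, 'p) atom = Pred 'p "'f trm list" | Eq "'f trm" "'f trm"

datatype ('f, 'p) lit = Pos "('f, 'p) atom" | Neg "('f, 'p) atom"

type_synonym ('f, 'p) conj = "('f, 'p) lit list"
type_synonym ('f, 'p) disj = "('f, 'p) conj list"

text \<open>Symbols are identified by name and arity.\<close>

record ('f, 'p) alphabet =
  funs :: "('f \<times> nat) set"
  preds :: "('p \<times> nat) set"

text \<open>As usual for Herbrand interpretations, the alphabet has a constant, i.e. there is a ground
  term. Without it, the program \<open>p \<leftrightarrow> \<exists>X. X = X\<close> would make \<open>p\<close> succeed although the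
  quantifier ranges over the empty set.\<close>

definition alphabet :: "('f, 'p) alphabet \<Rightarrow> bool" where
  "alphabet \<Sigma> \<longleftrightarrow> (\<exists>c. (c, 0) \<in> funs \<Sigma>)"

fun vars_trm :: "'f trm \<Rightarrow> nat set" where
  "vars_trm (Var x) = {x}"
| "vars_trm (Fun f ts) = (\<Union>t\<in>set ts. vars_trm t)"

fun vars_atom :: "('f, 'p) atom \<Rightarrow> nat set" where
  "vars_atom (Pred p ts) = (\<Union>t\<in>set ts. vars_trm t)"
| "vars_atom (Eq s t) = vars_trm s \<union> vars_trm t"

fun atom_of :: "('f, 'p) lit \<Rightarrow> ('f, 'p) atom" where
  "atom_of (Pos A) = A"
| "atom_of (Neg A) = A"

definition vars_conj :: "('f, 'p) conj \<Rightarrow> nat set" where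
  "vars_conj C = (\<Union>L\<in>set C. vars_atom (atom_of L))"

definition vars_disj :: "('f, 'p) disj \<Rightarrow> nat set" where
  "vars_disj D = (\<Union>C\<in>set D. vars_conj C)"

fun wf_trm :: "('f, 'p) alphabet \<Rightarrow> 'f trm \<Rightarrow> bool" where
  "wf_trm \<Sigma> (Var x) \<longleftrightarrow> True"
| "wf_trm \<Sigma> (Fun f ts) \<longleftrightarrow> (f, length ts) \<in> funs \<Sigma> \<and> (\<forall>t\<in>set ts. wf_trm \<Sigma> t)"

fun wf_atom :: "('f, 'p) alphabet \<Rightarrow> ('f, 'p) atom \<Rightarrow> bool" where
  "wf_atom \<Sigma> (Pred p ts) \<longleftrightarrow> (p, length ts) \<in> preds \<Sigma> \<and> (\<forall>t\<in>set ts. wf_trm \<Sigma> t)"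
| "wf_atom \<Sigma> (Eq s t) \<longleftrightarrow> wf_trm \<Sigma> s \<and> wf_trm \<Sigma> t"

definition ground_trms :: "('f, 'p) alphabet \<Rightarrow> 'f trm set" where
  "ground_trms \<Sigma> = {t. wf_trm \<Sigma> t \<and> vars_trm t = {}}"

definition ground_atoms :: "('f, 'p) alphabet \<Rightarrow> ('f, 'p) atom set" where
  "ground_atoms \<Sigma> = {A. wf_atom \<Sigma> A \<and> vars_atom A = {}}"

type_synonym 'f subst = "nat \<Rightarrow> 'f trm"

fun subst_trm :: "'f subst \<Rightarrow> 'f trm \<Rightarrow> 'f trm" where
  "subst_trm \<sigma> (Var x) = \<sigma> x"
| "subst_trm \<sigma> (Fun f ts) = Fun f (map (subst_trm \<sigma>) ts)"

fun subst_atom :: "'f subst \<Rightarrow> ('f, 'p) atom \<Rightarrow> ('f, 'p) atom" where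
  "subst_atom \<sigma> (Pred p ts) = Pred p (map (subst_trm \<sigma>) ts)"
| "subst_atom \<sigma> (Eq s t) = Eq (subst_trm \<sigma> s) (subst_trm \<sigma> t)"

fun subst_lit :: "'f subst \<Rightarrow> ('f, 'p) lit \<Rightarrow> ('f, 'p) lit" where
  "subst_lit \<sigma> (Pos A) = Pos (subst_atom \<sigma> A)"
| "subst_lit \<sigma> (Neg A) = Neg (subst_atom \<sigma> A)"

definition subst_conj :: "'f subst \<Rightarrow> ('f, 'p) conj \<Rightarrow> ('f, 'p) conj" where
  "subst_conj \<sigma> C = map (subst_lit \<sigma>) C"

definition subst_disj :: "'f subst \<Rightarrow> ('f, 'p) disj \<Rightarrow> ('f, 'p) disj" where
  "subst_disj \<sigma> D = map (subst_conj \<sigma>) D"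

text \<open>A predicate definition \<open>(p(V\<^sub>1,\<dots>,V\<^sub>n), \<exists>W[D])\<close>; the set \<open>W\<close> is determined by the rest.\<close>

record ('f, 'p) pdef =
  head_sym :: 'p
  head_vars :: "nat list"
  disjuncts :: "('f, 'p) disj"

definition head :: "('f, 'p) pdef \<Rightarrow> ('f, 'p) atom" where
  "head d = Pred (head_sym d) (map Var (head_vars d))"

definition local_vars :: "('f, 'p) pdef \<Rightarrow> nat set" where
  "local_vars d = vars_disj (disjuncts d) - set (head_vars d)"

definition wf_pdef :: "('f, 'p) alphabet \<Rightarrow> ('f, 'p) pdef \<Rightarrow> bool" where
  "wf_pdef \<Sigma> d \<longleftrightarrow> distinct (head_vars d) \<and> wf_atom \<Sigma> (head d) \<and> disjuncts d \<noteq> [] \<and>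
     (\<forall>C\<in>set (disjuncts d). \<forall>L\<in>set C. wf_atom \<Sigma> (atom_of L))"

type_synonym ('f, 'p) program = "('f, 'p) pdef set"

definition program :: "('f, 'p) alphabet \<Rightarrow> ('f, 'p) program \<Rightarrow> bool" where
  "program \<Sigma> P \<longleftrightarrow> finite P \<and> (\<forall>d\<in>P. wf_pdef \<Sigma> d) \<and>
     inj_on (\<lambda>d. (head_sym d, length (head_vars d))) P"


section \<open>Four-valued semantics\<close>

text \<open>The truth values \<open>u\<close>, \<open>f\<close>, \<open>t\<close>, \<open>i\<close>, in this order.\<close>

datatype tv = Undef | Fls | Tru | Incons

definition tv_of :: "bool \<Rightarrow> bool \<Rightarrow> tv" where
  "tv_of makes_true makes_false =
     (if makes_true then (if makes_false then Incons else Tru)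
      else (if makes_false then Fls else Undef))"

text \<open>Pairs \<open>(T, F)\<close>. The order \<open>\<le>\<close> on pairs of sets is componentwise inclusion
  (\<open>less_eq_prod_def\<close>), that is, the information order on interpretations.\<close>

type_synonym ('f, 'p) interp = "('f, 'p) atom set \<times> ('f, 'p) atom set"

definition interpretation4 :: "('f, 'p) alphabet \<Rightarrow> ('f, 'p) interp \<Rightarrow> bool" where
  "interpretation4 \<Sigma> I \<longleftrightarrow> fst I \<subseteq> ground_atoms \<Sigma> \<and> snd I \<subseteq> ground_atoms \<Sigma> \<and>
     (\<forall>s\<in>ground_trms \<Sigma>. \<forall>t\<in>ground_trms \<Sigma>.
        (Eq s t \<in> fst I \<longleftrightarrow> s = t) \<and> (Eq s t \<in> snd I \<longleftrightarrow> s \<noteq> t))"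

definition atom_val :: "('f, 'p) interp \<Rightarrow> ('f, 'p) atom \<Rightarrow> tv" where
  "atom_val I A = tv_of (A \<in> fst I) (A \<in> snd I)"

fun lit_true :: "('f, 'p) interp \<Rightarrow> ('f, 'p) lit \<Rightarrow> bool" where
  "lit_true I (Pos A) \<longleftrightarrow> A \<in> fst I"
| "lit_true I (Neg A) \<longleftrightarrow> A \<in> snd I"

fun lit_false :: "('f, 'p) interp \<Rightarrow> ('f, 'p) lit \<Rightarrow> bool" where
  "lit_false I (Pos A) \<longleftrightarrow> A \<in> snd I"
| "lit_false I (Neg A) \<longleftrightarrow> A \<in> fst I"

definition conj_true :: "('f, 'p) interp \<Rightarrow> ('f, 'p) conj \<Rightarrow> bool" where
  "conj_true I C \<longleftrightarrow> (\<forall>L\<in>set C. lit_true I L)"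

definition conj_false :: "('f, 'p) interp \<Rightarrow> ('f, 'p) conj \<Rightarrow> bool" where
  "conj_false I C \<longleftrightarrow> (\<exists>L\<in>set C. lit_false I L)"

definition disj_true :: "('f, 'p) interp \<Rightarrow> ('f, 'p) disj \<Rightarrow> bool" where
  "disj_true I D \<longleftrightarrow> (\<exists>C\<in>set D. conj_true I C)"

definition disj_false :: "('f, 'p) interp \<Rightarrow> ('f, 'p) disj \<Rightarrow> bool" where
  "disj_false I D \<longleftrightarrow> (\<forall>C\<in>set D. conj_false I C)"

text \<open>\<open>ex_true\<close> and \<open>ex_false\<close> interpret \<open>\<exists>W[D]\<close>, for \<open>D\<close> without variables outside \<open>W\<close>.\<close>

definition ex_true ::
    "('f, 'p) alphabet \<Rightarrow> ('f, 'p) interp \<Rightarrow> nat set \<Rightarrow> ('f, 'p) disj \<Rightarrow> bool" where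
  "ex_true \<Sigma> I W D \<longleftrightarrow>
     (\<exists>\<gamma>. (\<forall>x\<in>W. \<gamma> x \<in> ground_trms \<Sigma>) \<and> disj_true I (subst_disj \<gamma> D))"

definition ex_false ::
    "('f, 'p) alphabet \<Rightarrow> ('f, 'p) interp \<Rightarrow> nat set \<Rightarrow> ('f, 'p) disj \<Rightarrow> bool" where
  "ex_false \<Sigma> I W D \<longleftrightarrow>
     (\<forall>\<gamma>. (\<forall>x\<in>W. \<gamma> x \<in> ground_trms \<Sigma>) \<longrightarrow> disj_false I (subst_disj \<gamma> D))"

text \<open>For ground \<open>A\<close>: \<open>(A, \<exists>W[D])\<close> is a head grounding of a definition in \<open>P\<close>.\<close>

definition head_grounding ::
    "('f, 'p) program \<Rightarrow> ('f, 'p) atom \<Rightarrow> nat set \<Rightarrow> ('f, 'p) disj \<Rightarrow> bool" where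
  "head_grounding P A W D \<longleftrightarrow>
     (\<exists>d\<in>P. \<exists>\<theta>. (\<forall>x. x \<notin> set (head_vars d) \<longrightarrow> \<theta> x = Var x) \<and>
        A = subst_atom \<theta> (head d) \<and> W = local_vars d \<and> D = subst_disj \<theta> (disjuncts d))"

text \<open>In a program, a ground atom has at most one head grounding, so the two quantifiers over head
  groundings below agree whenever there is one. An atom whose predicate has no definition in \<open>P\<close> is
  false, as in the completion; accordingly it fails finitely under SLDNF resolution.\<close>

definition Phi ::
    "('f, 'p) alphabet \<Rightarrow> ('f, 'p) program \<Rightarrow> ('f, 'p) interp \<Rightarrow> ('f, 'p) interp" where
  "Phi \<Sigma> P I =
     ({Eq s s |s. s \<in> ground_trms \<Sigma>} \<union>
      {Pred p ts |p ts. Pred p ts \<in> ground_atoms \<Sigma> \<and>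
         (\<exists>W D. head_grounding P (Pred p ts) W D \<and> ex_true \<Sigma> I W D)},
      {Eq s t |s t. s \<in> ground_trms \<Sigma> \<and> t \<in> ground_trms \<Sigma> \<and> s \<noteq> t} \<union>
      {Pred p ts |p ts. Pred p ts \<in> ground_atoms \<Sigma> \<and>
         (\<forall>W D. head_grounding P (Pred p ts) W D \<longrightarrow> ex_false \<Sigma> I W D)})"

text \<open>\<open>Phi \<Sigma> P\<close> is defined on all pairs of sets, but it only returns interpretations. Hence its
  fixed points are interpretations, and \<open>lfp (Phi \<Sigma> P)\<close>, taken in the lattice of all pairs, is the
  least fixed point among the interpretations.\<close>

lemma interpretation4_Phi: "interpretation4 \<Sigma> (Phi \<Sigma> P I)"
  by (auto simp: interpretation4_def Phi_def ground_atoms_def ground_trms_def)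

lemma lit_mono:
  assumes "I \<le> J"
  shows "lit_true I L \<Longrightarrow> lit_true J L" and "lit_false I L \<Longrightarrow> lit_false J L"
  using assms by (cases L; auto simp: less_eq_prod_def)+

lemma ex_mono:
  assumes "I \<le> J"
  shows "ex_true \<Sigma> I W D \<Longrightarrow> ex_true \<Sigma> J W D" and "ex_false \<Sigma> I W D \<Longrightarrow> ex_false \<Sigma> J W D"
  unfolding ex_true_def ex_false_def disj_true_def disj_false_def conj_true_def conj_false_def
  using lit_mono[OF assms] by meson+

lemma mono_Phi:
  fixes P :: "('f, 'p) program"
  shows "mono (Phi \<Sigma> P)"
proof (rule monoI)
  fix I J :: "('f, 'p) interp"
  assume "I \<le> J"
  note 1 = ex_mono(1)[OF this] and 2 = ex_mono(2)[OF this]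
  show "Phi \<Sigma> P I \<le> Phi \<Sigma> P J"
    unfolding Phi_def less_eq_prod_def by (auto dest: 1) (meson 2)
qed

lemma head_grounding_unique:
  assumes P: "program \<Sigma> P"
    and 1: "head_grounding P A W D" and 2: "head_grounding P A W' D'"
  shows "W = W' \<and> D = D'"
proof -
  from 1 obtain d \<theta> where d: "d \<in> P" "\<And>x. x \<notin> set (head_vars d) \<Longrightarrow> \<theta> x = Var x"
    "A = subst_atom \<theta> (head d)" "W = local_vars d" "D = subst_disj \<theta> (disjuncts d)"
    unfolding head_grounding_def by blast
  from 2 obtain d' \<theta>' where d': "d' \<in> P" "\<And>x. x \<notin> set (head_vars d') \<Longrightarrow> \<theta>' x = Var x"
    "A = subst_atom \<theta>' (head d')" "W' = local_vars d'" "D' = subst_disj \<theta>' (disjuncts d')"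
    unfolding head_grounding_def by blast
  have eq: "head_sym d = head_sym d' \<and> map \<theta> (head_vars d) = map \<theta>' (head_vars d')"
    using d(3) d'(3) by (simp add: head_def comp_def)
  then have "length (head_vars d) = length (head_vars d')" by (metis length_map)
  with eq d(1) d'(1) P have "d = d'" unfolding program_def inj_on_def by blast
  moreover have "\<theta> = \<theta>'"
  proof
    fix x show "\<theta> x = \<theta>' x" using eq d(2) d'(2) \<open>d = d'\<close> by (cases "x \<in> set (head_vars d)") auto
  qed
  ultimately show ?thesis using d d' by simp
qed

lemma atom_val_Phi:
  assumes "program \<Sigma> P" and "Pred p ts \<in> ground_atoms \<Sigma>" and "head_grounding P (Pred p ts) W D"
  shows "atom_val (Phi \<Sigma> P I) (Pred p ts) = tv_of (ex_true \<Sigma> I W D) (ex_false \<Sigma> I W D)"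
proof -
  have "head_grounding P (Pred p ts) W' D' \<longleftrightarrow> W' = W \<and> D' = D" for W' D'
    using head_grounding_unique[OF assms(1) assms(3)] assms(3) by blast
  then show ?thesis using assms(2) by (simp add: atom_val_def Phi_def)
qed


section \<open>SLDNF resolution\<close>

text \<open>A disjunct \<open>C\<close> of a definition with head \<open>H\<close> yields the clause \<open>H \<leftarrow> C\<close>. Equality is
  defined by the clause \<open>X = X\<close>.\<close>

type_synonym ('f, 'p) clause = "('f, 'p) atom \<times> ('f, 'p) conj"

definition clauses :: "('f, 'p) program \<Rightarrow> ('f, 'p) clause set" where
  "clauses P = insert (Eq (Var 0) (Var 0), []) {(head d, C) |d C. d \<in> P \<and> C \<in> set (disjuncts d)}"

type_synonym ('f, 'p) goal = "('f, 'p) conj"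

definition unifies :: "'f subst \<Rightarrow> ('f, 'p) atom \<Rightarrow> ('f, 'p) atom \<Rightarrow> bool" where
  "unifies \<sigma> A B \<longleftrightarrow> subst_atom \<sigma> A = subst_atom \<sigma> B"

definition is_mgu :: "'f subst \<Rightarrow> ('f, 'p) atom \<Rightarrow> ('f, 'p) atom \<Rightarrow> bool" where
  "is_mgu \<theta> A B \<longleftrightarrow> unifies \<theta> A B \<and>
     (\<forall>\<tau>. unifies \<tau> A B \<longrightarrow> (\<exists>\<delta>. \<forall>x. \<tau> x = subst_trm \<delta> (\<theta> x)))"

text \<open>\<open>c'\<close> is a variant of the clause \<open>c\<close> standardised apart from the goal \<open>G\<close>. Variables of
  earlier goals need not be avoided, since no computed answers are recorded.\<close>

definition fresh_variant :: "('f, 'p) goal \<Rightarrow> ('f, 'p) clause \<Rightarrow> ('f, 'p) clause \<Rightarrow> bool" where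
  "fresh_variant G c c' \<longleftrightarrow>
     (\<exists>\<rho>. bij \<rho> \<and> c' = (subst_atom (Var \<circ> \<rho>) (fst c), subst_conj (Var \<circ> \<rho>) (snd c))) \<and>
     (vars_atom (fst c') \<union> vars_conj (snd c')) \<inter> vars_conj G = {}"

definition replace_lit :: "('f, 'p) goal \<Rightarrow> nat \<Rightarrow> ('f, 'p) conj \<Rightarrow> ('f, 'p) goal" where
  "replace_lit G n C = take n G @ C @ drop (Suc n) G"

definition resolvent ::
    "('f, 'p) goal \<Rightarrow> nat \<Rightarrow> ('f, 'p) atom \<Rightarrow> ('f, 'p) clause \<Rightarrow> ('f, 'p) goal \<Rightarrow> bool" where
  "resolvent G n A c G' \<longleftrightarrow>
     (\<exists>c' \<theta>. fresh_variant G c c' \<and> is_mgu \<theta> A (fst c') \<and>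
        G' = subst_conj \<theta> (replace_lit G n (snd c')))"

definition matching_clauses ::
    "('f, 'p) program \<Rightarrow> ('f, 'p) goal \<Rightarrow> ('f, 'p) atom \<Rightarrow> ('f, 'p) clause set" where
  "matching_clauses P G A =
     {c \<in> clauses P. \<exists>c' \<sigma>. fresh_variant G c c' \<and> unifies \<sigma> A (fst c')}"

text \<open>A node carries its goal, the position of the selected literal, and the subtrees.\<close>

datatype ('f, 'p) sldnf_tree = Node (root: "('f, 'p) goal") nat "('f, 'p) sldnf_tree list"

text \<open>A successful derivation is a sequence of goals ending with the empty goal. The selection of
  literals is arbitrary, except that negative literals are selected only when ground (otherwise the
  goal flounders). The mutual least fixed point replaces the usual stratification by ranks.\<close>

inductive successful_derivation :: "('f, 'p) program \<Rightarrow> ('f, 'p) goal list \<Rightarrow> bool"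
  and finitely_failed_tree :: "('f, 'p) program \<Rightarrow> ('f, 'p) sldnf_tree \<Rightarrow> bool"
  for P :: "('f, 'p) program" where
  succ_empty: "successful_derivation P [[]]"
| succ_pos:
    "\<lbrakk>n < length G; G ! n = Pos A; c \<in> clauses P; resolvent G n A c G';
      successful_derivation P (G' # Gs)\<rbrakk>
     \<Longrightarrow> successful_derivation P (G # G' # Gs)"
| succ_neg:
    "\<lbrakk>n < length G; G ! n = Neg A; vars_atom A = {};
      finitely_failed_tree P t; root t = [Pos A];
      G' = replace_lit G n []; successful_derivation P (G' # Gs)\<rbrakk>
     \<Longrightarrow> successful_derivation P (G # G' # Gs)"
| fail_pos:
    "\<lbrakk>n < length G; G ! n = Pos A; distinct cs; set cs = matching_clauses P G A;
      list_all2 (\<lambda>c t. resolvent G n A c (root t)) cs ts;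
      \<forall>t\<in>set ts. finitely_failed_tree P t\<rbrakk>
     \<Longrightarrow> finitely_failed_tree P (Node G n ts)"
| fail_neg_succ:
    "\<lbrakk>n < length G; G ! n = Neg A; vars_atom A = {};
      successful_derivation P ([Pos A] # Gs)\<rbrakk>
     \<Longrightarrow> finitely_failed_tree P (Node G n [])"
| fail_neg_fail:
    "\<lbrakk>n < length G; G ! n = Neg A; vars_atom A = {};
      finitely_failed_tree P t'; root t' = [Pos A];
      finitely_failed_tree P t; root t = replace_lit G n []\<rbrakk>
     \<Longrightarrow> finitely_failed_tree P (Node G n [t])"

definition succeeds :: "('f, 'p) program \<Rightarrow> ('f, 'p) atom \<Rightarrow> bool" where
  "succeeds P A \<longleftrightarrow> (\<exists>Gs. successful_derivation P ([Pos A] # Gs))"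

definition finitely_fails :: "('f, 'p) program \<Rightarrow> ('f, 'p) atom \<Rightarrow> bool" where
  "finitely_fails P A \<longleftrightarrow> (\<exists>t. finitely_failed_tree P t \<and> root t = [Pos A])"

end

theory Submission
  imports Defs
begin

text \<open>SLDNF resolution is sound for the least fixed point \<open>L\<close> of \<open>Phi \<Sigma> P\<close>: if a goal has a
  successful derivation, then some ground instance of it is true in \<open>L\<close>, and if it has a finitely
  failed tree, then all its ground instances are false in \<open>L\<close>. Both claims are proved together by
  induction on the derivation. A ground atom that succeeds is thus true in every \<open>I\<close> above \<open>L\<close>,
  and one that finitely fails is false there; neither excludes the value \<open>i\<close>.

  Ground terms are built over the alphabet, but most general unifiers range over all terms of the
  type, so goals must be shown to stay well-formed along derivations.\<close>

section \<open>Substitutions\<close>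

lemma subst_trm_comp: "subst_trm \<sigma> (subst_trm \<theta> t) = subst_trm (\<lambda>x. subst_trm \<sigma> (\<theta> x)) t"
  by (induction t) auto

lemma subst_atom_comp: "subst_atom \<sigma> (subst_atom \<theta> A) = subst_atom (\<lambda>x. subst_trm \<sigma> (\<theta> x)) A"
  by (cases A) (auto simp: subst_trm_comp)

lemma subst_lit_comp: "subst_lit \<sigma> (subst_lit \<theta> L) = subst_lit (\<lambda>x. subst_trm \<sigma> (\<theta> x)) L"
  by (cases L) (auto simp: subst_atom_comp)

lemma subst_conj_comp: "subst_conj \<sigma> (subst_conj \<theta> C) = subst_conj (\<lambda>x. subst_trm \<sigma> (\<theta> x)) C"
  by (simp add: subst_conj_def subst_lit_comp)

lemma subst_trm_cong: "(\<And>x. x \<in> vars_trm t \<Longrightarrow> \<sigma> x = \<tau> x) \<Longrightarrow> subst_trm \<sigma> t = subst_trm \<tau> t"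
  by (induction t) auto

lemma subst_atom_cong: "(\<And>x. x \<in> vars_atom A \<Longrightarrow> \<sigma> x = \<tau> x) \<Longrightarrow> subst_atom \<sigma> A = subst_atom \<tau> A"
  by (cases A) (auto intro: subst_trm_cong)

lemma subst_lit_cong:
  "(\<And>x. x \<in> vars_atom (atom_of L) \<Longrightarrow> \<sigma> x = \<tau> x) \<Longrightarrow> subst_lit \<sigma> L = subst_lit \<tau> L"
  by (cases L) (auto intro: subst_atom_cong)

lemma subst_conj_cong:
  "(\<And>x. x \<in> vars_conj C \<Longrightarrow> \<sigma> x = \<tau> x) \<Longrightarrow> subst_conj \<sigma> C = subst_conj \<tau> C"
  by (auto simp: subst_conj_def vars_conj_def intro!: subst_lit_cong)

lemma subst_trm_ident: "vars_trm t = {} \<Longrightarrow> subst_trm \<sigma> t = t"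
  by (induction t) (auto intro: map_idI)

lemma subst_atom_ident: "vars_atom A = {} \<Longrightarrow> subst_atom \<sigma> A = A"
  by (cases A) (auto simp: subst_trm_ident intro: map_idI)

lemma set_subst_conj: "set (subst_conj \<sigma> C) = subst_lit \<sigma> ` set C"
  by (simp add: subst_conj_def)

lemma atom_of_subst_lit: "atom_of (subst_lit \<sigma> L) = subst_atom \<sigma> (atom_of L)"
  by (cases L) auto

lemma vars_subst_trm: "vars_trm (subst_trm \<sigma> t) = (\<Union>x\<in>vars_trm t. vars_trm (\<sigma> x))"
  by (induction t) auto

lemma vars_subst_atom: "vars_atom (subst_atom \<sigma> A) = (\<Union>x\<in>vars_atom A. vars_trm (\<sigma> x))"
  by (cases A) (auto simp: vars_subst_trm)

lemma vars_subst_conj: "vars_conj (subst_conj \<sigma> C) = (\<Union>x\<in>vars_conj C. vars_trm (\<sigma> x))"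
  by (auto simp: vars_conj_def set_subst_conj atom_of_subst_lit vars_subst_atom)

lemma wf_subst_trm:
  "wf_trm \<Sigma> (subst_trm \<sigma> t) \<longleftrightarrow> wf_trm \<Sigma> t \<and> (\<forall>x\<in>vars_trm t. wf_trm \<Sigma> (\<sigma> x))"
  by (induction t) auto

lemma wf_subst_atom:
  "wf_atom \<Sigma> (subst_atom \<sigma> A) \<longleftrightarrow> wf_atom \<Sigma> A \<and> (\<forall>x\<in>vars_atom A. wf_trm \<Sigma> (\<sigma> x))"
  by (cases A) (auto simp: wf_subst_trm)

section \<open>Finiteness of variable sets, for renaming apart\<close>

lemma finite_vars_trm: "finite (vars_trm t)"
  by (induction t) auto

lemma finite_vars_atom: "finite (vars_atom A)"
  by (cases A) (auto simp: finite_vars_trm)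

lemma finite_vars_conj: "finite (vars_conj C)"
  by (auto simp: vars_conj_def finite_vars_atom)

text \<open>Groundness is required at every variable, not just at those of a particular goal.
  Instances can then be composed without tracking domains; irrelevant variables are sent to a
  constant.\<close>

definition ground_subst :: "('f, 'p) alphabet \<Rightarrow> 'f subst \<Rightarrow> bool" where
  "ground_subst \<Sigma> \<gamma> \<longleftrightarrow> (\<forall>x. \<gamma> x \<in> ground_trms \<Sigma>)"

lemma ground_trm_exists:
  assumes "alphabet \<Sigma>"
  obtains c where "Fun c [] \<in> ground_trms \<Sigma>"
  using assms by (auto simp: alphabet_def ground_trms_def)

text \<open>Both directions matter: from a single ground instance one recovers that \<open>t\<close>
  is well-formed and that the substitution is ground on the variables of \<open>t\<close>.\<close>

lemma subst_trm_ground: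
  "subst_trm \<sigma> t \<in> ground_trms \<Sigma> \<longleftrightarrow> wf_trm \<Sigma> t \<and> (\<forall>x\<in>vars_trm t. \<sigma> x \<in> ground_trms \<Sigma>)"
  by (auto simp: ground_trms_def wf_subst_trm vars_subst_trm)

lemma subst_atom_ground:
  "subst_atom \<sigma> A \<in> ground_atoms \<Sigma> \<longleftrightarrow> wf_atom \<Sigma> A \<and> (\<forall>x\<in>vars_atom A. \<sigma> x \<in> ground_trms \<Sigma>)"
  by (auto simp: ground_trms_def ground_atoms_def wf_subst_atom vars_subst_atom)


section \<open>Well-formed goals\<close>

definition wf_conj :: "('f, 'p) alphabet \<Rightarrow> ('f, 'p) conj \<Rightarrow> bool" where
  "wf_conj \<Sigma> C \<longleftrightarrow> (\<forall>L\<in>set C. wf_atom \<Sigma> (atom_of L))"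

lemma wf_subst_conj:
  "wf_conj \<Sigma> (subst_conj \<sigma> C) \<longleftrightarrow> wf_conj \<Sigma> C \<and> (\<forall>x\<in>vars_conj C. wf_trm \<Sigma> (\<sigma> x))"
  by (auto simp: wf_conj_def vars_conj_def set_subst_conj atom_of_subst_lit wf_subst_atom)

lemma subset_set_replace_lit:
  assumes "n < length G"
  shows "set G \<subseteq> insert (G ! n) (set (replace_lit G n C))"
  by (subst (1) id_take_nth_drop[OF assms]) (auto simp: replace_lit_def)

lemma set_replace_lit_subset: "set (replace_lit G n C) \<subseteq> set G \<union> set C"
  by (auto simp: replace_lit_def dest: in_set_takeD in_set_dropD)

lemma wf_replace_lit: "wf_conj \<Sigma> G \<Longrightarrow> wf_conj \<Sigma> C \<Longrightarrow> wf_conj \<Sigma> (replace_lit G n C)"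
  unfolding wf_conj_def using set_replace_lit_subset by fast

text \<open>A retraction of all terms of the type onto the ground terms over the alphabet: variables
  and subterms headed by a foreign symbol collapse to the constant \<open>c\<close>.\<close>

fun ground_repair :: "('f, 'p) alphabet \<Rightarrow> 'f \<Rightarrow> 'f trm \<Rightarrow> 'f trm" where
  "ground_repair \<Sigma> c (Var x) = Fun c []"
| "ground_repair \<Sigma> c (Fun f ts) =
     (if (f, length ts) \<in> funs \<Sigma> then Fun f (map (ground_repair \<Sigma> c) ts) else Fun c [])"

lemma ground_repair_ground:
  "Fun c [] \<in> ground_trms \<Sigma> \<Longrightarrow> ground_repair \<Sigma> c t \<in> ground_trms \<Sigma>"
  by (induction t) (auto simp: ground_trms_def)

text \<open>The repair is homomorphic on symbols of the alphabet, so it passes through a well-formed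
  \<open>t\<close> and acts only on the substituted terms.\<close>

lemma ground_repair_subst_trm:
  "wf_trm \<Sigma> t \<Longrightarrow> ground_repair \<Sigma> c (subst_trm \<sigma> t) = subst_trm (\<lambda>x. ground_repair \<Sigma> c (\<sigma> x)) t"
  by (induction t) auto

text \<open>Applying the repair to both sides of the unification equation gives an equation again,
  and it commutes with the two well-formed atoms.\<close>

lemma unifies_ground_repair:
  assumes "unifies \<sigma> A B" and "wf_atom \<Sigma> A" and "wf_atom \<Sigma> B"
  shows "unifies (\<lambda>x. ground_repair \<Sigma> c (\<sigma> x)) A B"
proof (cases A)
  case (Pred p ts)
  with assms obtain us where B: "B = Pred p us" by (cases B) (auto simp: unifies_def)
  have "map (ground_repair \<Sigma> c) (map (subst_trm \<sigma>) ts) = map (ground_repair \<Sigma> c) (map (subst_trm \<sigma>) us)"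
    using assms(1) Pred B by (simp add: unifies_def del: map_map)
  moreover have "map (ground_repair \<Sigma> c) (map (subst_trm \<sigma>) vs) =
      map (subst_trm (\<lambda>x. ground_repair \<Sigma> c (\<sigma> x))) vs" if "\<forall>v\<in>set vs. wf_trm \<Sigma> v" for vs
    using that by (auto simp: ground_repair_subst_trm)
  ultimately show ?thesis using assms(2,3) Pred B by (simp add: unifies_def del: map_map)
next
  case (Eq s t)
  with assms show ?thesis
    by (cases B) (auto simp: unifies_def ground_repair_subst_trm[symmetric])
qed

text \<open>Instances of \<open>\<theta> x\<close> include the values of the repaired unifier, which are well-formed.\<close>

lemma is_mgu_wf:
  assumes "alphabet \<Sigma>" and "is_mgu \<theta> A B" and "wf_atom \<Sigma> A" and "wf_atom \<Sigma> B"
  shows "wf_trm \<Sigma> (\<theta> x)"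
proof -
  obtain c where c: "Fun c [] \<in> ground_trms \<Sigma>" using ground_trm_exists[OF assms(1)] .
  have "unifies (\<lambda>x. ground_repair \<Sigma> c (\<theta> x)) A B"
    using unifies_ground_repair assms(2-4) by (auto simp: is_mgu_def)
  then obtain \<delta> where "\<And>x. ground_repair \<Sigma> c (\<theta> x) = subst_trm \<delta> (\<theta> x)"
    using assms(2) unfolding is_mgu_def by blast
  with ground_repair_ground[OF c, of "\<theta> x"] show ?thesis by (simp add: subst_trm_ground)
qed

lemma wf_clause:
  assumes "program \<Sigma> P" and "c \<in> clauses P"
  shows "wf_atom \<Sigma> (fst c)" and "wf_conj \<Sigma> (snd c)"
  using assms by (auto simp: clauses_def program_def wf_pdef_def wf_conj_def)

lemma wf_fresh_variant:
  assumes "fresh_variant G c c'" and "wf_atom \<Sigma> (fst c)" and "wf_conj \<Sigma> (snd c)"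
  shows "wf_atom \<Sigma> (fst c')" and "wf_conj \<Sigma> (snd c')"
  using assms by (auto simp: fresh_variant_def wf_subst_atom wf_subst_conj)

lemma wf_resolvent:
  assumes "alphabet \<Sigma>" and "program \<Sigma> P" and "c \<in> clauses P" and "wf_conj \<Sigma> G"
    and "n < length G" and "G ! n = Pos A" and "resolvent G n A c G'"
  shows "wf_conj \<Sigma> G'"
proof -
  obtain c' \<theta> where c': "fresh_variant G c c'" "is_mgu \<theta> A (fst c')"
    and G': "G' = subst_conj \<theta> (replace_lit G n (snd c'))"
    using assms(7) unfolding resolvent_def by blast
  note wf = wf_fresh_variant[OF c'(1) wf_clause[OF assms(2,3)]]
  have "wf_atom \<Sigma> A" using assms(4-6) unfolding wf_conj_def by (metis atom_of.simps(1) nth_mem)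
  then show ?thesis
    using is_mgu_wf[OF assms(1) c'(2) _ wf(1)] wf_replace_lit[OF assms(4) wf(2)]
    by (simp add: G' wf_subst_conj)
qed


section \<open>Fresh variants\<close>

text \<open>Variants are taken along bijections of all variables, so an injection on
  \<open>V\<close> would not suffice. Exchanging two adjacent blocks of numbers gives a bijection at
  once.\<close>

lemma bij_avoiding:
  fixes U V :: "nat set"
  assumes "finite U" and "finite V"
  obtains \<rho> where "bij \<rho>" and "\<rho> ` V \<inter> U = {}"
proof -
  obtain N where N: "\<And>x. x \<in> U \<union> V \<Longrightarrow> x < N"
    using assms finite_nat_set_iff_bounded[of "U \<union> V"] by auto
  \<comment> \<open>Swaps \<open>{0..<N}\<close> with \<open>{N..<2*N}\<close>. As \<open>N\<close>
    bounds both sets, \<open>V\<close> is moved above all of \<open>U\<close>.\<close>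
  define \<rho> where "\<rho> x = (if x < N then x + N else if x < 2 * N then x - N else x)" for x
  have "\<rho> (\<rho> x) = x" for x by (auto simp: \<rho>_def)
  then have "bij \<rho>" by (rule involuntory_imp_bij)
  moreover have "\<rho> ` V \<inter> U = {}" using N by (fastforce simp: \<rho>_def)
  ultimately show ?thesis using that by blast
qed

lemma fresh_variant_exists:
  obtains c' where "fresh_variant G c c'"
proof -
  obtain \<rho> where \<rho>: "bij \<rho>" "\<rho> ` (vars_atom (fst c) \<union> vars_conj (snd c)) \<inter> vars_conj G = {}"
    using bij_avoiding[of "vars_conj G" "vars_atom (fst c) \<union> vars_conj (snd c)"]
    by (auto simp: finite_vars_atom finite_vars_conj)
  have "fresh_variant G c (subst_atom (Var \<circ> \<rho>) (fst c), subst_conj (Var \<circ> \<rho>) (snd c))"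
    unfolding fresh_variant_def using \<rho> by (auto simp: vars_subst_atom vars_subst_conj)
  then show ?thesis using that by blast
qed

text \<open>Composing \<gamma> with the renaming turns an instance of the variant into an instance
  of the original clause.\<close>

lemma fresh_variant_instance:
  assumes "fresh_variant G c c'" and "ground_subst \<Sigma> \<gamma>"
  obtains \<kappa> where "ground_subst \<Sigma> \<kappa>"
    and "subst_atom \<gamma> (fst c') = subst_atom \<kappa> (fst c)"
    and "subst_conj \<gamma> (snd c') = subst_conj \<kappa> (snd c)"
proof -
  obtain \<rho> where "c' = (subst_atom (Var \<circ> \<rho>) (fst c), subst_conj (Var \<circ> \<rho>) (snd c))"
    using assms(1) unfolding fresh_variant_def by blast
  with assms(2) show ?thesis
    by (intro that[of "\<lambda>x. \<gamma> (\<rho> x)"]) (auto simp: ground_subst_def subst_atom_comp subst_conj_comp)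
qed

text \<open>Standardising apart makes it possible to instantiate goal and clause independently by
  one substitution. This is the basis for lifting ground resolution steps.\<close>

lemma fresh_variant_combine:
  assumes "fresh_variant G c c'" and "ground_subst \<Sigma> \<gamma>" and "ground_subst \<Sigma> \<kappa>"
  obtains \<sigma> where "ground_subst \<Sigma> \<sigma>" and "\<And>x. x \<in> vars_conj G \<Longrightarrow> \<sigma> x = \<gamma> x"
    and "subst_atom \<sigma> (fst c') = subst_atom \<kappa> (fst c)"
    and "subst_conj \<sigma> (snd c') = subst_conj \<kappa> (snd c)"
proof -
  obtain \<rho> where \<rho>: "bij \<rho>" and c': "c' = (subst_atom (Var \<circ> \<rho>) (fst c), subst_conj (Var \<circ> \<rho>) (snd c))"
    and disj: "(vars_atom (fst c') \<union> vars_conj (snd c')) \<inter> vars_conj G = {}"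
    using assms(1) unfolding fresh_variant_def by blast
  \<comment> \<open>The inverse renaming leads from the variant back to the clause, where \<kappa>
    applies. Variables of the variant never fall into the first case.\<close>
  define \<sigma> where "\<sigma> x = (if x \<in> vars_conj G then \<gamma> x else \<kappa> (inv \<rho> x))" for x
  have inv: "inv \<rho> (\<rho> x) = x" for x using \<rho> by (simp add: bij_is_inj)
  have "\<sigma> (\<rho> x) = \<kappa> x" if "x \<in> vars_atom (fst c) \<union> vars_conj (snd c)" for x
    using that disj by (auto simp: c' \<sigma>_def inv vars_subst_atom vars_subst_conj)
  then show ?thesis
    using assms(2,3) by (intro that[of \<sigma>])
      (auto simp: \<sigma>_def[of "_ :: nat"] c' ground_subst_def subst_atom_comp subst_conj_comp
        intro!: subst_atom_cong subst_conj_cong)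
qed


section \<open>Ground clause instances and \<open>Phi\<close>\<close>

text \<open>A ground clause instance splits into a head grounding, given by \<gamma> on the head
  variables, and a choice of witnesses for the local ones, given by \<gamma> itself.\<close>

lemma Phi_trueI:
  assumes "program \<Sigma> P" and "c \<in> clauses P" and "ground_subst \<Sigma> \<gamma>"
    and "conj_true I (subst_conj \<gamma> (snd c))"
  shows "subst_atom \<gamma> (fst c) \<in> fst (Phi \<Sigma> P I)"
proof (cases "c = (Eq (Var 0) (Var 0), [])")
  case True
  then show ?thesis using assms(3) by (simp add: Phi_def ground_subst_def)
next
  case False
  then obtain d C where d: "d \<in> P" "C \<in> set (disjuncts d)" and c: "c = (head d, C)"
    using assms(2) unfolding clauses_def by auto
  define \<theta> where "\<theta> x = (if x \<in> set (head_vars d) then \<gamma> x else Var x)" for x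
  have head: "subst_atom \<gamma> (head d) = subst_atom \<theta> (head d)"
    by (rule subst_atom_cong) (auto simp: head_def \<theta>_def)
  \<comment> \<open>The terms that \<theta> puts in for head variables are ground and hence
    untouched by \<gamma>.\<close>
  have "(\<lambda>x. subst_trm \<gamma> (\<theta> x)) = \<gamma>"
    using assms(3) by (auto simp: \<theta>_def ground_subst_def ground_trms_def subst_trm_ident)
  then have "subst_conj \<gamma> (subst_conj \<theta> C) = subst_conj \<gamma> C" by (simp add: subst_conj_comp)
  then have "disj_true I (subst_disj \<gamma> (subst_disj \<theta> (disjuncts d)))"
    using assms(4) d c by (force simp: disj_true_def subst_disj_def)
  then have "ex_true \<Sigma> I (local_vars d) (subst_disj \<theta> (disjuncts d))"
    using assms(3) by (auto simp: ex_true_def ground_subst_def)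
  moreover have "head_grounding P (subst_atom \<gamma> (head d)) (local_vars d) (subst_disj \<theta> (disjuncts d))"
    unfolding head_grounding_def using d(1) head
    by (intro bexI[of _ d] exI[of _ \<theta>]) (auto simp: \<theta>_def)
  moreover have "subst_atom \<gamma> (head d) \<in> ground_atoms \<Sigma>"
    using wf_clause(1)[OF assms(1,2)] assms(3) c by (simp add: subst_atom_ground ground_subst_def)
  ultimately show ?thesis
    by (auto simp: Phi_def c head_def)
qed

text \<open>Falsity of \<open>A\<close> needs all instances of all disjuncts to be false, and each
  of them is the body of a ground clause instance with head \<open>A\<close>. An undefined predicate
  is covered vacuously.\<close>

lemma Phi_falseI:
  assumes "alphabet \<Sigma>" and "A \<in> ground_atoms \<Sigma>"
    and "\<And>c \<gamma>. c \<in> clauses P \<Longrightarrow> ground_subst \<Sigma> \<gamma> \<Longrightarrow> subst_atom \<gamma> (fst c) = A \<Longrightarrow>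
      conj_false I (subst_conj \<gamma> (snd c))"
  shows "A \<in> snd (Phi \<Sigma> P I)"
proof (cases A)
  case (Eq s t)
  \<comment> \<open>Otherwise \<open>A\<close> would be an instance of the clause for equality,
    whose empty body is never false.\<close>
  have "s \<noteq> t"
  proof
    assume "s = t"
    then have "conj_false I (subst_conj (\<lambda>_. s) [])"
      using assms(3)[of "(Eq (Var 0) (Var 0), [])" "\<lambda>_. s"] assms(2) Eq
      by (simp add: clauses_def ground_subst_def ground_atoms_def ground_trms_def)
    then show False by (simp add: conj_false_def subst_conj_def)
  qed
  then show ?thesis using assms(2) Eq by (simp add: Phi_def ground_atoms_def ground_trms_def)
next
  case (Pred p ts)
  obtain c0 where c0: "Fun c0 [] \<in> ground_trms \<Sigma>" using ground_trm_exists[OF assms(1)] .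
  have "ex_false \<Sigma> I W D" if "head_grounding P A W D" for W D
    unfolding ex_false_def disj_false_def
  proof (intro allI impI ballI)
    fix \<gamma> E
    assume \<gamma>: "\<forall>x\<in>W. \<gamma> x \<in> ground_trms \<Sigma>" and E: "E \<in> set (subst_disj \<gamma> D)"
    obtain d \<theta> where d: "d \<in> P" "\<And>x. x \<notin> set (head_vars d) \<Longrightarrow> \<theta> x = Var x"
      "A = subst_atom \<theta> (head d)" "W = local_vars d" "D = subst_disj \<theta> (disjuncts d)"
      using \<open>head_grounding P A W D\<close> unfolding head_grounding_def by metis
    obtain C where C: "C \<in> set (disjuncts d)" "E = subst_conj \<gamma> (subst_conj \<theta> C)"
      using E d(5) by (auto simp: subst_disj_def)
    \<comment> \<open>Glues the head grounding and the local instance into one substitution; the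
      constant only makes it ground everywhere.\<close>
    define \<kappa> where "\<kappa> x = (if x \<in> set (head_vars d) then \<theta> x else if x \<in> W then \<gamma> x else Fun c0 [])" for x
    have gr: "\<theta> x \<in> ground_trms \<Sigma>" if "x \<in> set (head_vars d)" for x
      using assms(2) that by (auto simp: d(3) head_def ground_atoms_def ground_trms_def)
    have "ground_subst \<Sigma> \<kappa>" using gr \<gamma> c0 by (simp add: ground_subst_def \<kappa>_def)
    moreover have "subst_atom \<kappa> (head d) = A"
      unfolding d(3) by (rule subst_atom_cong) (auto simp: head_def \<kappa>_def)
    moreover have "E = subst_conj \<kappa> C"
      unfolding C subst_conj_comp
    proof (rule subst_conj_cong)
      fix x assume x: "x \<in> vars_conj C"
      show "subst_trm \<gamma> (\<theta> x) = \<kappa> x"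
      proof (cases "x \<in> set (head_vars d)")
        case True
        then show ?thesis using gr[OF True] by (simp add: \<kappa>_def ground_trms_def subst_trm_ident)
      next
        case False
        then have "x \<in> W" using x C(1) by (auto simp: d(4) local_vars_def vars_disj_def)
        with False show ?thesis by (simp add: \<kappa>_def d(2))
      qed
    qed
    moreover have "(head d, C) \<in> clauses P" using d(1) C(1) by (auto simp: clauses_def)
    ultimately show "conj_false I E" using assms(3)[of "(head d, C)" \<kappa>] by simp
  qed
  then show ?thesis using assms(2) Pred by (auto simp: Phi_def)
qed


section \<open>Soundness of resolution\<close>

lemma conj_true_replace_lit:
  assumes "n < length G" and "lit_true I (subst_lit \<gamma> (G ! n))"
    and "conj_true I (subst_conj \<gamma> (replace_lit G n C))"
  shows "conj_true I (subst_conj \<gamma> G)"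
  using assms subset_set_replace_lit[OF assms(1), of C] unfolding conj_true_def set_subst_conj by blast

lemma conj_false_replace_lit:
  assumes "conj_false I (subst_conj \<gamma> (replace_lit G n C))"
  shows "conj_false I (subst_conj \<gamma> G) \<or> conj_false I (subst_conj \<gamma> C)"
  using assms set_replace_lit_subset[of G n C] unfolding conj_false_def set_subst_conj by blast

text \<open>Following the unifier by \<gamma> makes the selected atom and the clause head equal. The
  clause body is part of the true resolvent, so the fixed point property makes that atom true as
  well.\<close>

lemma resolvent_true:
  assumes "alphabet \<Sigma>" and "program \<Sigma> P" and "c \<in> clauses P" and "wf_conj \<Sigma> G"
    and "n < length G" and "G ! n = Pos A" and "resolvent G n A c G'"
    and "I = Phi \<Sigma> P I" and "ground_subst \<Sigma> \<gamma>" and "conj_true I (subst_conj \<gamma> G')"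
  obtains \<tau> where "ground_subst \<Sigma> \<tau>" and "conj_true I (subst_conj \<tau> G)"
proof -
  obtain c' \<theta> where c': "fresh_variant G c c'" "is_mgu \<theta> A (fst c')"
    and G': "G' = subst_conj \<theta> (replace_lit G n (snd c'))"
    using assms(7) unfolding resolvent_def by blast
  have wfA: "wf_atom \<Sigma> A" using assms(4-6) unfolding wf_conj_def by (metis atom_of.simps(1) nth_mem)
  \<comment> \<open>Without this, \<tau> could take values outside the alphabet.\<close>
  have wf_mgu: "wf_trm \<Sigma> (\<theta> x)" for x
    using is_mgu_wf[OF assms(1) c'(2) wfA wf_fresh_variant(1)[OF c'(1) wf_clause[OF assms(2,3)]]] .
  define \<tau> where "\<tau> x = subst_trm \<gamma> (\<theta> x)" for x
  have \<tau>: "ground_subst \<Sigma> \<tau>"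
    using wf_mgu assms(9) by (simp add: ground_subst_def \<tau>_def subst_trm_ground)
  have true: "conj_true I (subst_conj \<tau> (replace_lit G n (snd c')))"
    using assms(10) by (simp add: G' subst_conj_comp \<tau>_def[abs_def])
  have "subst_atom \<theta> A = subst_atom \<theta> (fst c')" using c'(2) by (simp add: is_mgu_def unifies_def)
  then have "subst_atom \<gamma> (subst_atom \<theta> A) = subst_atom \<gamma> (subst_atom \<theta> (fst c'))" by simp
  then have eq: "subst_atom \<tau> A = subst_atom \<tau> (fst c')"
    by (simp add: subst_atom_comp \<tau>_def[abs_def])
  obtain \<kappa> where \<kappa>: "ground_subst \<Sigma> \<kappa>" "subst_atom \<tau> (fst c') = subst_atom \<kappa> (fst c)"
    "subst_conj \<tau> (snd c') = subst_conj \<kappa> (snd c)"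
    using fresh_variant_instance[OF c'(1) \<tau>] .
  have "conj_true I (subst_conj \<tau> (snd c'))"
    using true by (auto simp: conj_true_def set_subst_conj replace_lit_def)
  then have "conj_true I (subst_conj \<kappa> (snd c))" by (simp only: \<kappa>(3))
  then have "subst_atom \<tau> A \<in> fst I"
    using Phi_trueI[OF assms(2,3) \<kappa>(1)] assms(8) eq \<kappa>(2) by metis
  then have "conj_true I (subst_conj \<tau> G)"
    using conj_true_replace_lit[OF assms(5) _ true] assms(6) by simp
  with \<tau> show ?thesis by (rule that)
qed

text \<open>Guarantees that a failed tree has a subtree for every clause that could make an instance
  of the selected atom true.\<close>

lemma matching_clausesI:
  assumes "c \<in> clauses P" and "ground_subst \<Sigma> \<gamma>" and "ground_subst \<Sigma> \<kappa>"
    and "subst_atom \<kappa> (fst c) = subst_atom \<gamma> A" and "vars_atom A \<subseteq> vars_conj G"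
  shows "c \<in> matching_clauses P G A"
proof -
  obtain c' where c': "fresh_variant G c c'" using fresh_variant_exists .
  obtain \<sigma> where \<sigma>: "\<And>x. x \<in> vars_conj G \<Longrightarrow> \<sigma> x = \<gamma> x"
    "subst_atom \<sigma> (fst c') = subst_atom \<kappa> (fst c)"
    using fresh_variant_combine[OF c' assms(2,3)] by metis
  have "subst_atom \<sigma> A = subst_atom \<gamma> A" using \<sigma>(1) assms(5) by (intro subst_atom_cong) auto
  then have "unifies \<sigma> A (fst c')" using \<sigma>(2) assms(4) by (simp add: unifies_def)
  then show ?thesis using assms(1) c' unfolding matching_clauses_def by blast
qed

text \<open>A lifting argument: instances \<gamma> of the goal and \<kappa> of the clause that agree
  on atom and head form a unifier, which factors through the most general one. The false literal of
  the resulting resolvent instance comes from the goal or from the clause body.\<close>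

lemma resolvent_false:
  assumes "alphabet \<Sigma>" and "resolvent G n A c G'" and "vars_atom A \<subseteq> vars_conj G"
    and "ground_subst \<Sigma> \<gamma>" and "ground_subst \<Sigma> \<kappa>"
    and "subst_atom \<kappa> (fst c) = subst_atom \<gamma> A"
    and false: "\<And>\<eta>. ground_subst \<Sigma> \<eta> \<Longrightarrow> conj_false I (subst_conj \<eta> G')"
  shows "conj_false I (subst_conj \<gamma> G) \<or> conj_false I (subst_conj \<kappa> (snd c))"
proof -
  obtain c' \<theta> where c': "fresh_variant G c c'" "is_mgu \<theta> A (fst c')"
    and G': "G' = subst_conj \<theta> (replace_lit G n (snd c'))"
    using assms(2) unfolding resolvent_def by blast
  obtain \<sigma> where \<sigma>: "ground_subst \<Sigma> \<sigma>" "\<And>x. x \<in> vars_conj G \<Longrightarrow> \<sigma> x = \<gamma> x"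
    "subst_atom \<sigma> (fst c') = subst_atom \<kappa> (fst c)"
    "subst_conj \<sigma> (snd c') = subst_conj \<kappa> (snd c)"
    using fresh_variant_combine[OF c'(1) assms(4,5)] by metis
  have "subst_atom \<sigma> A = subst_atom \<gamma> A" using \<sigma>(2) assms(3) by (intro subst_atom_cong) auto
  then have "unifies \<sigma> A (fst c')" using \<sigma>(3) assms(6) by (simp add: unifies_def)
  then obtain \<delta> where \<delta>: "\<And>x. \<sigma> x = subst_trm \<delta> (\<theta> x)" using c'(2) unfolding is_mgu_def by blast
  obtain c0 where c0: "Fun c0 [] \<in> ground_trms \<Sigma>" using ground_trm_exists[OF assms(1)] .
  \<comment> \<open>\<open>\<delta>\<close> need not be ground on variables that occur in no \<open>\<theta> x\<close>.\<close>
  define \<eta> where "\<eta> y = (if \<delta> y \<in> ground_trms \<Sigma> then \<delta> y else Fun c0 [])" for y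
  have \<eta>: "ground_subst \<Sigma> \<eta>" using c0 by (simp add: ground_subst_def \<eta>_def)
  have "subst_trm \<eta> (\<theta> x) = \<sigma> x" for x
    unfolding \<delta>
  proof (rule subst_trm_cong)
    fix y assume "y \<in> vars_trm (\<theta> x)"
    moreover have "subst_trm \<delta> (\<theta> x) \<in> ground_trms \<Sigma>" using \<sigma>(1) \<delta> by (metis ground_subst_def)
    ultimately show "\<eta> y = \<delta> y" by (simp add: subst_trm_ground \<eta>_def)
  qed
  then have "conj_false I (subst_conj \<sigma> (replace_lit G n (snd c')))"
    using false[OF \<eta>] by (simp add: G' subst_conj_comp)
  then have "conj_false I (subst_conj \<sigma> G) \<or> conj_false I (subst_conj \<sigma> (snd c'))"
    by (rule conj_false_replace_lit)
  moreover have "subst_conj \<sigma> G = subst_conj \<gamma> G" using \<sigma>(2) by (rule subst_conj_cong)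
  ultimately show ?thesis using \<sigma>(4) by simp
qed

text \<open>Any fixed point will do. Success yields just one true instance, because unifiers may
  bind goal variables, while failure concerns all instances. For a negative literal the gap
  vanishes, as its atom is ground.\<close>

theorem sldnf_sound:
  fixes P :: "('f, 'p) program"
  assumes "alphabet \<Sigma>" and "program \<Sigma> P" and I: "I = Phi \<Sigma> P I"
  shows "successful_derivation P Gs \<Longrightarrow> wf_conj \<Sigma> (hd Gs) \<Longrightarrow>
      \<exists>\<gamma>. ground_subst \<Sigma> \<gamma> \<and> conj_true I (subst_conj \<gamma> (hd Gs))"
    and "finitely_failed_tree P t \<Longrightarrow> wf_conj \<Sigma> (root t) \<Longrightarrow>
      \<forall>\<gamma>. ground_subst \<Sigma> \<gamma> \<longrightarrow> conj_false I (subst_conj \<gamma> (root t))"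
proof (induction rule: successful_derivation_finitely_failed_tree.inducts)
  case succ_empty
  obtain c0 where "Fun c0 [] \<in> ground_trms \<Sigma>" using ground_trm_exists[OF assms(1)] .
  then have "ground_subst \<Sigma> (\<lambda>_. Fun c0 [])" by (simp add: ground_subst_def)
  then show ?case by (auto simp: conj_true_def subst_conj_def)
next
  case (succ_pos n G A c G' Gs)
  then have wf: "wf_conj \<Sigma> G" by simp
  have "wf_conj \<Sigma> G'"
    using wf_resolvent[OF assms(1,2) succ_pos(4) wf succ_pos(1-3)] .
  then obtain \<gamma> where \<gamma>: "ground_subst \<Sigma> \<gamma>" "conj_true I (subst_conj \<gamma> G')"
    using succ_pos(6) by auto
  show ?case
    using resolvent_true[OF assms(1,2) succ_pos(4) wf succ_pos(1-3) I \<gamma>] by auto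
next
  case (succ_neg n G A t G' Gs)
  then have wf: "wf_conj \<Sigma> G" by simp
  then have wfA: "wf_conj \<Sigma> [Pos A]"
    using succ_neg.hyps(1,2) unfolding wf_conj_def by (metis atom_of.simps empty_iff empty_set nth_mem set_ConsD)
  have "wf_conj \<Sigma> G'" unfolding succ_neg(5)
    by (rule wf_replace_lit[OF wf]) (simp add: wf_conj_def)
  then obtain \<gamma> where \<gamma>: "ground_subst \<Sigma> \<gamma>" "conj_true I (subst_conj \<gamma> G')"
    using succ_neg(9) by auto
  have "conj_false I (subst_conj \<gamma> [Pos A])"
    using succ_neg(4,7) wfA \<gamma>(1) by simp
  then have "lit_true I (subst_lit \<gamma> (G ! n))"
    using succ_neg.hyps(2) by (simp add: conj_false_def subst_conj_def)
  then have "conj_true I (subst_conj \<gamma> G)"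
    using conj_true_replace_lit[OF succ_neg.hyps(1)] \<gamma>(2) succ_neg(5) by simp
  with \<gamma>(1) show ?case by auto
next
  case (fail_pos n G A cs ts)
  then have wf: "wf_conj \<Sigma> G" by simp
  have mem: "Pos A \<in> set G" using fail_pos.hyps(1,2) by (metis nth_mem)
  then have vA: "vars_atom A \<subseteq> vars_conj G" unfolding vars_conj_def by force
  have wfA: "wf_atom \<Sigma> A" using wf mem unfolding wf_conj_def by force
  have "conj_false I (subst_conj \<gamma> G)" if \<gamma>: "ground_subst \<Sigma> \<gamma>" for \<gamma>
  \<comment> \<open>If the instance of the goal is not false, \<open>resolvent_false\<close> leaves
    only false bodies for all clauses with a matching instance. Then the selected atom is false at
    the fixed point, and so is the goal.\<close>
  proof (rule ccontr)
    assume nf: "\<not> conj_false I (subst_conj \<gamma> G)"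
    have "subst_atom \<gamma> A \<in> snd (Phi \<Sigma> P I)"
    proof (rule Phi_falseI[OF assms(1)])
      show "subst_atom \<gamma> A \<in> ground_atoms \<Sigma>"
        using wfA \<gamma> by (simp add: subst_atom_ground ground_subst_def)
    next
      fix c \<kappa>
      assume c: "c \<in> clauses P" and \<kappa>: "ground_subst \<Sigma> \<kappa>" "subst_atom \<kappa> (fst c) = subst_atom \<gamma> A"
      have "c \<in> set cs" using matching_clausesI[OF c \<gamma> \<kappa> vA] fail_pos(5) by simp
      then obtain i where i: "i < length cs" "cs ! i = c" by (auto simp: in_set_conv_nth)
      then have t: "ts ! i \<in> set ts" "resolvent G n A c (root (ts ! i))"
        using fail_pos(4) by (auto simp: list_all2_conv_all_nth)
      have "wf_conj \<Sigma> (root (ts ! i))"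
        using wf_resolvent[OF assms(1,2) c wf fail_pos.hyps(1,2) t(2)] .
      then have "conj_false I (subst_conj \<eta> (root (ts ! i)))" if "ground_subst \<Sigma> \<eta>" for \<eta>
        using fail_pos(6) t(1) that by blast
      from resolvent_false[OF assms(1) t(2) vA \<gamma> \<kappa> this] nf
      show "conj_false I (subst_conj \<kappa> (snd c))" by blast
    qed
    then have "subst_atom \<gamma> A \<in> snd I" using I by simp
    then have "lit_false I (subst_lit \<gamma> (Pos A))" by simp
    with mem nf show False unfolding conj_false_def set_subst_conj by blast
  qed
  then show ?case by simp
next
  case (fail_neg_succ n G A Gs)
  have mem: "Neg A \<in> set G" using fail_neg_succ.hyps(1,2) by (metis nth_mem)
  then have "wf_conj \<Sigma> [Pos A]" using fail_neg_succ.prems unfolding wf_conj_def by force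
  then obtain \<gamma>' where "conj_true I (subst_conj \<gamma>' [Pos A])" using fail_neg_succ(5) by auto
  \<comment> \<open>Groundness of \<open>A\<close> makes the unknown \<gamma>' irrelevant, so the
    conclusion serves every instance of the goal.\<close>
  then have "A \<in> fst I"
    using fail_neg_succ.hyps(3) by (simp add: conj_true_def subst_conj_def subst_atom_ident)
  then have "lit_false I (subst_lit \<gamma> (Neg A))" for \<gamma>
    using fail_neg_succ.hyps(3) by (simp add: subst_atom_ident)
  with mem show ?case by (auto simp: conj_false_def set_subst_conj intro!: bexI)
next
  case (fail_neg_fail n G A t' t)
  have "wf_conj \<Sigma> (root t)" unfolding fail_neg_fail(5)
    using fail_neg_fail.prems by (intro wf_replace_lit) (simp_all add: wf_conj_def)
  then have "conj_false I (subst_conj \<gamma> (replace_lit G n []))" if "ground_subst \<Sigma> \<gamma>" for \<gamma>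
    using fail_neg_fail(5,9) that by simp
  \<comment> \<open>The replacement is empty, hence never false, so the false literal already occurs
    in \<open>G\<close>.\<close>
  then have "conj_false I (subst_conj \<gamma> G)" if "ground_subst \<Sigma> \<gamma>" for \<gamma>
    using conj_false_replace_lit[of I \<gamma> G n "[]"] that by (auto simp: conj_false_def subst_conj_def)
  then show ?case by simp
qed

section \<open>Consequences for ground atoms\<close>

lemma succeeds_true:
  assumes "alphabet \<Sigma>" and "program \<Sigma> P" and "I = Phi \<Sigma> P I"
    and "A \<in> ground_atoms \<Sigma>" and "succeeds P A"
  shows "A \<in> fst I"
proof -
  obtain Gs where "successful_derivation P ([Pos A] # Gs)"
    using assms(5) by (auto simp: succeeds_def)
  from sldnf_sound(1)[OF assms(1-3) this] obtain \<gamma> where "conj_true I (subst_conj \<gamma> [Pos A])"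
    using assms(4) by (auto simp: wf_conj_def ground_atoms_def)
  then show ?thesis
    using assms(4) by (simp add: conj_true_def subst_conj_def subst_atom_ident ground_atoms_def)
qed

lemma finitely_fails_false:
  assumes "alphabet \<Sigma>" and "program \<Sigma> P" and "I = Phi \<Sigma> P I"
    and "A \<in> ground_atoms \<Sigma>" and "finitely_fails P A"
  shows "A \<in> snd I"
proof -
  obtain t where t: "finitely_failed_tree P t" "root t = [Pos A]"
    using assms(5) by (auto simp: finitely_fails_def)
  obtain c0 where "Fun c0 [] \<in> ground_trms \<Sigma>" using ground_trm_exists[OF assms(1)] .
  then have "ground_subst \<Sigma> (\<lambda>_. Fun c0 [])" by (simp add: ground_subst_def)
  then have "conj_false I (subst_conj (\<lambda>_. Fun c0 []) [Pos A])"
    using sldnf_sound(2)[OF assms(1-3) t(1)] t(2) assms(4)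
    by (auto simp: wf_conj_def ground_atoms_def)
  then show ?thesis
    using assms(4) by (simp add: conj_false_def subst_conj_def subst_atom_ident ground_atoms_def)
qed

theorem theorem6p3:
  fixes \<Sigma> :: "('f, 'p) alphabet"
    and P :: "('f, 'p) program"
    and I :: "('f, 'p) interp"
  assumes "alphabet \<Sigma>"
    and "program \<Sigma> P"
    and "interpretation4 \<Sigma> I"
    and "lfp (Phi \<Sigma> P) \<le> I"
  shows "\<forall>A\<in>ground_atoms \<Sigma>.
    (atom_val I A = Tru \<longrightarrow> \<not> finitely_fails P A) \<and>
    (atom_val I A = Fls \<longrightarrow> \<not> succeeds P A) \<and>
    (atom_val I A = Undef \<longrightarrow> \<not> finitely_fails P A \<and> \<not> succeeds P A)"
proof
  fix A assume A: "A \<in> ground_atoms \<Sigma>"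
  \<comment> \<open>\<open>I\<close> itself need not be a fixed point, so soundness is applied to
    the least one and the memberships are carried upwards.\<close>
  have fp: "lfp (Phi \<Sigma> P) = Phi \<Sigma> P (lfp (Phi \<Sigma> P))" using mono_Phi by (rule lfp_unfold)
  have "succeeds P A \<Longrightarrow> A \<in> fst I"
    using succeeds_true[OF assms(1,2) fp A] assms(4) by (auto simp: less_eq_prod_def)
  moreover have "finitely_fails P A \<Longrightarrow> A \<in> snd I"
    using finitely_fails_false[OF assms(1,2) fp A] assms(4) by (auto simp: less_eq_prod_def)
  ultimately show "(atom_val I A = Tru \<longrightarrow> \<not> finitely_fails P A) \<and>
      (atom_val I A = Fls \<longrightarrow> \<not> succeeds P A) \<and>
      (atom_val I A = Undef \<longrightarrow> \<not> finitely_fails P A \<and> \<not> succeeds P A)"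
    by (auto simp: atom_val_def tv_of_def split: if_splits)
qed

end
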